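(* Let $S=(\{(z_i,v_i)\}_{i\in\mathcal I},\{(x_k,\delta_k)\}_{k\in\mathcal K})$ be a set of observations with $z_i,x_k\in\mathbb R^d$, $v_i\in\mathbb R^d\setminus\{0\}$ and $\delta_k\ge 0$. If $S$ is $\mathcal C_{\alpha,\beta,D}$-interpolable, then $S\in\mathrm{Interp}(\alpha,\beta,D;1)$.
   Context: Sets. $\langle\cdot,\cdot\rangle$, $\|\cdot\|$ are the Euclidean inner product and norm on $\mathbb R^d$; $B(x,r)$ is the closed ball of radius $r$ centered at $x$. For a nonempty closed convex $C\subseteq\mathbb R^d$: $N_C(z)=\{v:\langle v,x-z\rangle\le 0\ \forall x\in C\}$ is the normal cone at $z\in\mathrm{bdry}\,C$; $\mathrm{diam}(C)=\sup\{\|x-y\|:x,y\in C\}$; $\mathrm{int}_\delta C=\{x: B(x,\delta)\subseteq C\}$ (so $\mathrm{int}_0C=C$). $C$ is $\beta$-smooth if $B(z-\frac1\beta n,\frac1\beta)\subseteq C$ for every $z\in\mathrm{bdry}\,C$ and unit vector $n\in N_C(z)$; $C$ is $\alpha$-strongly convex if $B(z-\frac1\alpha n,\frac1\alpha)\supseteq C$ for every $z\in\mathrm{bdry}\,C$ and unit $n\in N_C(z)$. Limiting values are allowed: every closed convex set is $\infty$-smooth and $0$-strongly convex, and the only $\infty$-strongly convex sets are singletons. $\mathcal C_{\alpha,\beta,D}$ is the set of nonempty closed convex sets that are $\alpha$-strongly convex, $\beta$-smooth and have $\mathrm{diam}(C)\le D$. Interpolability. $S$ is $\mathcal C_{\alpha,\beta,D}$-interpolable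 if there exists $C\in\mathcal C_{\alpha,\beta,D}$ with $z_i\in C$ and $v_i\in N_C(z_i)$ for all $i\in\mathcal I$, and $x_k\in\mathrm{int}_{\delta_k}C$ for all $k\in\mathcal K$. The index sets $\mathcal I,\mathcal K$ need not have the same size nor both be nonempty. Conditions. Parameters: $0\le\alpha\le\beta\le\infty$, $\beta>0$, $D\in[0,\infty]$, with $1/\infty=0$. Put $n_i=v_i/\|v_i\|$, $\gamma=(\frac1\alpha-\frac1\beta)^{-1}$ (with $\frac1\gamma=0$ if $\alpha=\beta$), $s_k=\max\{0,\delta_k-\frac1\beta\}$. For $\lambda\in[\frac1{\sqrt2},1]$, write $S\in\mathrm{Interp}(\alpha,\beta,D;\lambda)$ if there exist $\{w_k\}_{k\in\mathcal K}\subset\mathbb R^d$ such that for all $i,j\in\mathcal I$ and $k,l\in\mathcal K$: (1) $\|z_i-\frac1\alpha n_i-(z_j-\frac1\beta n_j)\|\le\frac1\gamma$; (2) $\|z_i-\frac1\alpha n_i-w_k\|\le\frac1\gamma-s_k$; (3) $\|x_k-w_k\|\le\frac1\beta-\delta_k+s_k$; (4) $\|z_i-\frac1\beta n_i-(z_j-\frac1\beta n_j)\|\le\lambda(D-\frac2\beta)$; (5) $\|z_i-\frac1\beta n_i-w_k\|\le\lambda(D-\frac2\beta)-s_k$; (6) $\|w_k-w_l\|\le\lambda(D-\frac2\beta)-s_k-s_l$. If $\alpha=0$, conditions (1) and (2) are understood as their limits as $\alpha\to0$: $\langle n_i,z_j-\frac1\beta n_j-z_i+\frac1\beta n_i\rangle\le0$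 and $\langle n_i,w_k+s_kn_i-z_i+\frac1\beta n_i\rangle\le0$. If $D=\infty$, (4)-(6) are vacuous. *)

theory Defs
  imports "HOL-Analysis.Analysis"
begin

(* The parameters alpha, beta, D are extended reals in [0, infinity]. *)

definition recip :: "ereal \<Rightarrow> real" where
  \<comment> \<open>\<open>1 / a\<close> as a real number, with \<open>1 / \<infinity> = 0\<close>; meaningful only for \<open>a \<noteq> 0\<close>.\<close>
  "recip a = real_of_ereal (1 / a)"

definition normal_cone :: "'a::euclidean_space set \<Rightarrow> 'a \<Rightarrow> 'a set" where
  "normal_cone C z = {v. \<forall>x\<in>C. v \<bullet> (x - z) \<le> 0}"

definition ediam :: "'a::euclidean_space set \<Rightarrow> ereal" where
  \<comment> \<open>The library's \<open>diameter\<close> is real-valued and unspecified on unbounded sets.\<close>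
  "ediam C = (SUP (x, y) \<in> C \<times> C. ereal (norm (x - y)))"

definition inner_parallel :: "real \<Rightarrow> 'a::euclidean_space set \<Rightarrow> 'a set" where
  "inner_parallel \<delta> C = {x. cball x \<delta> \<subseteq> C}"

definition smooth_set :: "ereal \<Rightarrow> 'a::euclidean_space set \<Rightarrow> bool" where
  \<comment> \<open>For \<open>\<beta> = \<infinity>\<close> the balls are single boundary points, so the condition holds for all closed sets.\<close>
  "smooth_set \<beta> C \<longleftrightarrow>
     (\<forall>z\<in>frontier C. \<forall>n\<in>normal_cone C z. norm n = 1 \<longrightarrow>
        cball (z - recip \<beta> *\<^sub>R n) (recip \<beta>) \<subseteq> C)"

definition strongly_convex_set :: "ereal \<Rightarrow> 'a::euclidean_space set \<Rightarrow> bool" where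
  \<comment> \<open>The case \<open>\<alpha> = \<infinity>\<close> is separate because the ball condition with radius \<open>0\<close> also holds,
      vacuously, for the whole space, whose frontier is empty.\<close>
  "strongly_convex_set \<alpha> C \<longleftrightarrow>
     (if \<alpha> = 0 then True
      else if \<alpha> = \<infinity> then \<exists>c. C = {c}
      else \<forall>z\<in>frontier C. \<forall>n\<in>normal_cone C z. norm n = 1 \<longrightarrow>
             C \<subseteq> cball (z - recip \<alpha> *\<^sub>R n) (recip \<alpha>))"

definition conv_class :: "ereal \<Rightarrow> ereal \<Rightarrow> ereal \<Rightarrow> 'a::euclidean_space set set" where
  "conv_class \<alpha> \<beta> D =
     {C. C \<noteq> {} \<and> closed C \<and> convex C \<and>
         strongly_convex_set \<alpha> C \<and> smooth_set \<beta> C \<and> ediam C \<le> D}"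

(* Observations are families (z i, v i), i in I, and (x k, delta k), k in K. For z in C and v \<noteq> 0,
   membership of v in the normal cone at z forces z to lie on the boundary of C. *)

definition interpolable ::
  "ereal \<Rightarrow> ereal \<Rightarrow> ereal \<Rightarrow> 'i set \<Rightarrow> ('i \<Rightarrow> 'a::euclidean_space) \<Rightarrow> ('i \<Rightarrow> 'a) \<Rightarrow>
   'k set \<Rightarrow> ('k \<Rightarrow> 'a) \<Rightarrow> ('k \<Rightarrow> real) \<Rightarrow> bool" where
  "interpolable \<alpha> \<beta> D I z v K x \<delta> \<longleftrightarrow>
     (\<exists>C\<in>conv_class \<alpha> \<beta> D.
        (\<forall>i\<in>I. z i \<in> C \<and> v i \<in> normal_cone C (z i)) \<and>
        (\<forall>k\<in>K. x k \<in> inner_parallel (\<delta> k) C))"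

definition gam :: "ereal \<Rightarrow> ereal \<Rightarrow> ereal" where
  \<comment> \<open>For \<open>0 < \<alpha> = \<beta>\<close> this is \<open>inverse 0 = \<infinity>\<close>, so that \<open>recip (gam \<alpha> \<beta>) = 0\<close>.\<close>
  "gam \<alpha> \<beta> = inverse (1 / \<alpha> - 1 / \<beta>)"

definition interp ::
  "ereal \<Rightarrow> ereal \<Rightarrow> ereal \<Rightarrow> real \<Rightarrow> 'i set \<Rightarrow> ('i \<Rightarrow> 'a::euclidean_space) \<Rightarrow> ('i \<Rightarrow> 'a) \<Rightarrow>
   'k set \<Rightarrow> ('k \<Rightarrow> 'a) \<Rightarrow> ('k \<Rightarrow> real) \<Rightarrow> bool" where
  \<comment> \<open>For \<open>\<alpha> = 0\<close> the first two conditions are replaced by their limits as \<open>\<alpha> \<rightarrow> 0\<close>.\<close>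
  "interp \<alpha> \<beta> D lam I z v K x \<delta> \<longleftrightarrow>
    (let a = recip \<alpha>; b = recip \<beta>; g = recip (gam \<alpha> \<beta>); R = lam * (real_of_ereal D - 2 * b);
         n = (\<lambda>i. v i /\<^sub>R norm (v i));
         s = (\<lambda>k. max 0 (\<delta> k - b))
     in \<exists>w :: 'k \<Rightarrow> 'a.
       (\<forall>i\<in>I. \<forall>j\<in>I.
         (if \<alpha> = 0 then n i \<bullet> (z j - b *\<^sub>R n j - z i + b *\<^sub>R n i) \<le> 0
          else norm (z i - a *\<^sub>R n i - (z j - b *\<^sub>R n j)) \<le> g)) \<and>
       (\<forall>i\<in>I. \<forall>k\<in>K.
         (if \<alpha> = 0 then n i \<bullet> (w k + s k *\<^sub>R n i - z i + b *\<^sub>R n i) \<le> 0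
          else norm (z i - a *\<^sub>R n i - w k) \<le> g - s k)) \<and>
       (\<forall>k\<in>K. norm (x k - w k) \<le> b - \<delta> k + s k) \<and>
       (D \<noteq> \<infinity> \<longrightarrow>
         (\<forall>i\<in>I. \<forall>j\<in>I. norm (z i - b *\<^sub>R n i - (z j - b *\<^sub>R n j)) \<le> R) \<and>
         (\<forall>i\<in>I. \<forall>k\<in>K. norm (z i - b *\<^sub>R n i - w k) \<le> R - s k) \<and>
         (\<forall>k\<in>K. \<forall>l\<in>K. norm (w k - w l) \<le> R - s k - s l)))"

end

theory Submission
  imports Defs
begin

text \<open>
  Write \<open>b = 1/\<beta>\<close> and \<open>a = 1/\<alpha>\<close>. The interpolation conditions compare balls that lie inside \<open>C\<close>
  with sets that contain \<open>C\<close>. By smoothness, each observed boundary point \<open>z i\<close> with unit normal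
  \<open>n i\<close> carries the ball of radius \<open>b\<close> around \<open>z i - b n i\<close>. Each interior observation \<open>x k\<close>
  carries a ball of radius \<open>b + s k\<close> around a suitable \<open>w k\<close> close to \<open>x k\<close>
  (\<open>smooth_set_inscribed_ball_near\<close>): if \<open>\<delta> k \<ge> b\<close> this is the given ball itself. Otherwise,
  unless a ball of radius \<open>b\<close> around \<open>x k\<close> already fits, one follows the inner normal at the
  boundary point nearest to \<open>x k\<close> up to depth \<open>b\<close>.

  The bound on \<open>norm (x k - w k)\<close> comes with that construction. Every other condition restricts
  the position of a ball \<open>cball p r\<close> inside \<open>C\<close>, or of two such balls. If \<open>\<alpha> > 0\<close>, then \<open>C\<close>
  lies in the ball of radius \<open>a\<close> around \<open>z i - a n i\<close>, and a ball of radius \<open>r\<close> inside a ball of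
  radius \<open>a\<close> has its centre within \<open>a - r\<close> of the other centre. If \<open>\<alpha> = 0\<close>, the extreme point
  \<open>p + r n i\<close> of the ball satisfies the normal inequality at \<open>z i\<close>. The diameter conditions
  come from the two mutually farthest points of two inscribed balls
  (\<open>inscribed_balls_dist_le\<close>).
\<close>

section \<open>Normal cones and inscribed balls\<close>

lemma normal_cone_frontier:
  fixes C :: "'a::euclidean_space set"
  assumes "z \<in> C" "v \<in> normal_cone C z" "v \<noteq> 0"
  shows "z \<in> frontier C"
proof -
  have "z \<notin> interior C"
  proof
    assume "z \<in> interior C"
    then obtain e where e: "e > 0" "cball z e \<subseteq> C"
      by (auto simp: mem_interior_cball)
    have "z + (e / norm v) *\<^sub>R v \<in> cball z e"
      using e \<open>v \<noteq> 0\<close> by (simp add: dist_norm)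
    then have "v \<bullet> ((e / norm v) *\<^sub>R v) \<le> 0"
      using e(2) assms(2) unfolding normal_cone_def by fastforce
    moreover have "0 < v \<bullet> ((e / norm v) *\<^sub>R v)"
      using e(1) \<open>v \<noteq> 0\<close> by simp
    ultimately show False by linarith
  qed
  then show ?thesis
    using \<open>z \<in> C\<close> closure_subset by (auto simp: frontier_def)
qed

lemma normal_cone_scaleR:
  "v \<in> normal_cone C z \<Longrightarrow> 0 \<le> c \<Longrightarrow> c *\<^sub>R v \<in> normal_cone C z"
  by (auto simp: normal_cone_def mult_nonneg_nonpos)

lemma normal_cone_ball_le:
  fixes n :: "'a::euclidean_space"
  assumes "n \<in> normal_cone C z" "norm n = 1" "cball p r \<subseteq> C" "0 \<le> r"
  shows "n \<bullet> (p + r *\<^sub>R n - z) \<le> 0"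
proof -
  have "p + r *\<^sub>R n \<in> cball p r"
    using assms(2,4) by (simp add: dist_norm)
  then show ?thesis
    using assms(1,3) by (auto simp: normal_cone_def)
qed

lemma inscribed_balls_dist_le:
  fixes C :: "'a::euclidean_space set"
  assumes "ediam C \<le> D" "0 \<le> D" "D \<noteq> \<infinity>"
    and "cball p r \<subseteq> C" "cball q t \<subseteq> C" "0 \<le> r" "0 \<le> t"
  shows "norm (p - q) \<le> real_of_ereal D - r - t"
proof -
  \<comment> \<open>When the centres coincide, any direction serves.\<close>
  obtain u :: 'a where u: "norm u = 1" "p - q = norm (p - q) *\<^sub>R u"
  proof (cases "p = q")
    case True
    obtain u :: 'a where "norm u = 1"
      using vector_choose_size[of 1] by auto
    with True that show thesis by simp
  next
    case False
    then show thesis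
      by (intro that[of "(p - q) /\<^sub>R norm (p - q)"]) auto
  qed
  have "p + r *\<^sub>R u \<in> C" "q - t *\<^sub>R u \<in> C"
    using assms u(1) by (auto simp: dist_norm subset_iff)
  then have "ereal (norm (p + r *\<^sub>R u - (q - t *\<^sub>R u))) \<le> ediam C"
    unfolding ediam_def by (intro SUP_upper2[of "(p + r *\<^sub>R u, q - t *\<^sub>R u)"]) auto
  also have "p + r *\<^sub>R u - (q - t *\<^sub>R u) = (norm (p - q) + r + t) *\<^sub>R u"
    by (subst scaleR_add_left, subst scaleR_add_left, subst u(2)[symmetric]) (simp add: algebra_simps)
  finally have "ereal (norm (p - q) + r + t) \<le> ediam C"
    using u(1) assms(6,7) by simp
  with assms(1) have "ereal (norm (p - q) + r + t) \<le> D"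
    by (rule order_trans[rotated])
  with assms(2,3) show ?thesis
    by (cases D) auto
qed

section \<open>Balls of the smoothness radius near interior points\<close>

text \<open>
  An inscribed ball that touches the boundary at \<open>z\<close> forces the supporting hyperplane at \<open>z\<close> to be
  tangent to the ball, so that the centre lies on the inner normal at \<open>z\<close>. For radius \<open>0\<close> this is
  just the existence of a unit normal. Quantitatively, \<open>x + r n\<close> in \<open>C\<close> gives \<open>r \<le> n \<bullet> (z - x)\<close>
  while \<open>norm (z - x) = r\<close>, and this equality case of Cauchy-Schwarz yields \<open>z - x = r n\<close>.
\<close>

lemma touching_ball_normal:
  fixes C :: "'a::euclidean_space set"
  assumes "convex C" "z \<in> frontier C" "cball x (dist x z) \<subseteq> C"
  obtains n where "n \<in> normal_cone C z" "norm n = 1" "x = z - dist x z *\<^sub>R n"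
proof -
  define r where "r = dist x z"
  obtain c where c: "c \<noteq> 0" "\<And>y. y \<in> closure C \<Longrightarrow> c \<bullet> z \<le> c \<bullet> y"
  proof (cases "interior C = {}")
    case True
    then obtain c h where c: "c \<noteq> 0" "C \<subseteq> {y. c \<bullet> y = h}"
      using empty_interior_subset_hyperplane[OF assms(1)] by metis
    have "closure C \<subseteq> {y. c \<bullet> y = h}"
      using c(2) closed_hyperplane by (rule closure_minimal)
    then have eq: "c \<bullet> y = h" if "y \<in> closure C" for y
      using that by blast
    from assms(2) have "z \<in> closure C"
      by (simp add: frontier_def)
    with c(1) eq show thesis
      by (intro that[of c]) simp_all
  next
    case False
    then have "z \<in> closure C" "z \<notin> rel_interior C"
      using assms(2) rel_interior_nonempty_interior[of C] by (simp_all add: frontier_def)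
    with assms(1) show thesis
      by (rule supporting_hyperplane_relative_frontier) (rule that)
  qed
  define n where "n = (1 / norm c) *\<^sub>R (- c)"
  have n: "n \<in> normal_cone C z" "norm n = 1"
  proof -
    have "- c \<in> normal_cone C z"
      using c(2) closure_subset[of C] by (auto simp: normal_cone_def inner_diff_right)
    then show "n \<in> normal_cone C z"
      unfolding n_def by (rule normal_cone_scaleR) simp
    show "norm n = 1"
      using c(1) by (simp add: n_def)
  qed
  have nn: "n \<bullet> n = 1"
    using n(2) by (simp add: dot_square_norm)
  have "r \<le> n \<bullet> (z - x)"
    using normal_cone_ball_le[OF n assms(3)] nn
    by (simp add: r_def inner_add_right inner_diff_right)
  have "(norm (z - x - r *\<^sub>R n))\<^sup>2 = (norm (z - x))\<^sup>2 - 2 * r * (n \<bullet> (z - x)) + r\<^sup>2"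
    unfolding power2_norm_eq_inner
    using nn by (simp add: inner_diff inner_commute power2_eq_square algebra_simps)
  also have "\<dots> = 2 * r * (r - n \<bullet> (z - x))"
    by (simp add: r_def dist_norm norm_minus_commute power2_eq_square algebra_simps)
  also have "\<dots> \<le> 0"
    using \<open>r \<le> n \<bullet> (z - x)\<close> by (simp add: r_def mult_nonneg_nonpos)
  finally have "x = z - r *\<^sub>R n"
    by (simp add: algebra_simps)
  with n show thesis
    unfolding r_def by (rule that)
qed

text \<open>
  Take \<open>z\<close> nearest to \<open>x\<close> on the frontier. The open ball up to \<open>z\<close> is connected, meets \<open>C\<close> and
  misses the frontier, so it cannot leave \<open>C\<close>; any larger ball would make \<open>z\<close> interior.
\<close>

lemma largest_inscribed_ball:
  fixes C :: "'a::euclidean_space set"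
  assumes "closed C" "x \<in> C" "frontier C \<noteq> {}"
  obtains z where "z \<in> frontier C" "cball x (dist x z) \<subseteq> C"
    "\<And>d. cball x d \<subseteq> C \<Longrightarrow> d \<le> dist x z"
proof -
  obtain z where z: "z \<in> frontier C" "\<And>y. y \<in> frontier C \<Longrightarrow> dist x z \<le> dist x y"
    using distance_attains_inf[OF frontier_closed assms(3)] by metis
  have "cball x (dist x z) \<subseteq> C"
  proof (cases "dist x z = 0")
    case True
    with assms(2) show ?thesis by simp
  next
    case False
    then have pos: "0 < dist x z" by simp
    have "ball x (dist x z) \<subseteq> C"
    proof (rule ccontr)
      assume "\<not> ball x (dist x z) \<subseteq> C"
      then have "ball x (dist x z) \<inter> frontier C \<noteq> {}"
        using connected_Int_frontier[OF connected_ball, of x "dist x z" C] pos assms(2)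
          centre_in_ball[of x "dist x z"] by blast
      with z(2) show False by fastforce
    qed
    then have "closure (ball x (dist x z)) \<subseteq> C"
      using assms(1) by (rule closure_minimal)
    with pos show ?thesis by simp
  qed
  moreover have "d \<le> dist x z" if "cball x d \<subseteq> C" for d
  proof (rule ccontr)
    assume "\<not> d \<le> dist x z"
    then have "z \<in> ball x d" by simp
    also have "ball x d \<subseteq> interior C"
      using that ball_subset_cball by (intro interior_maximal) auto
    finally show False
      using z(1) by (simp add: frontier_def)
  qed
  ultimately show thesis
    using z(1) that by blast
qed

text \<open>
  This produces the points \<open>w k\<close>. Only the case \<open>\<delta> < b\<close>, where the given ball is too small, has
  content, and only if \<open>C\<close> is not the whole space: the largest ball around \<open>x\<close>, of radius \<open>r\<close> with \<open>\<delta> \<le> r\<close>, touches the boundary at some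
  \<open>z\<close>. If it is still smaller than \<open>b\<close>, then \<open>x\<close> lies at depth \<open>r\<close> on the inner normal at \<open>z\<close>, and
  smoothness provides the ball of radius \<open>b\<close> at depth \<open>b\<close> on the same normal, at distance
  \<open>b - r \<le> b - \<delta>\<close> from \<open>x\<close>.
\<close>

lemma smooth_set_inscribed_ball_near:
  fixes C :: "'a::euclidean_space set"
  assumes "closed C" "convex C" "smooth_set \<beta> C" "x \<in> inner_parallel \<delta> C" "0 \<le> \<delta>"
  defines "b \<equiv> recip \<beta>"
  defines "s \<equiv> max 0 (\<delta> - b)"
  shows "\<exists>w. cball w (b + s) \<subseteq> C \<and> norm (x - w) \<le> b - \<delta> + s"
proof (cases "b \<le> \<delta>")
  case True
  then show ?thesis
    using assms(4) by (intro exI[of _ x]) (auto simp: s_def inner_parallel_def)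
next
  case False
  then have s: "s = 0" and "\<delta> < b" by (auto simp: s_def)
  have ball: "cball x \<delta> \<subseteq> C"
    using assms(4) by (simp add: inner_parallel_def)
  then have "x \<in> C"
    using assms(5) by auto
  show ?thesis
  proof (cases "frontier C = {}")
    case True
    then have "C = UNIV"
      using \<open>x \<in> C\<close> frontier_eq_empty by blast
    with s \<open>\<delta> < b\<close> show ?thesis
      by (intro exI[of _ x]) auto
  next
    case False
    obtain z where z: "z \<in> frontier C" "cball x (dist x z) \<subseteq> C" "\<delta> \<le> dist x z"
      using largest_inscribed_ball[OF assms(1) \<open>x \<in> C\<close> False] ball by metis
    show ?thesis
    proof (cases "b \<le> dist x z")
      case True
      then have "cball x b \<subseteq> C"
        using z(2) by (meson order_trans subset_cball)
      with s \<open>\<delta> < b\<close> show ?thesis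
        by (intro exI[of _ x]) auto
    next
      case False
      obtain n where n: "n \<in> normal_cone C z" "norm n = 1" "x = z - dist x z *\<^sub>R n"
        using touching_ball_normal[OF assms(2) z(1,2)] by metis
      have "cball (z - b *\<^sub>R n) b \<subseteq> C"
        using assms(3) z(1) n(1,2) by (simp add: smooth_set_def b_def)
      moreover have "norm (x - (z - b *\<^sub>R n)) = b - dist x z"
      proof -
        have "x - (z - b *\<^sub>R n) = (b - dist x z) *\<^sub>R n"
          by (subst n(3)) (simp add: algebra_simps)
        then show ?thesis
          using False n(2) by simp
      qed
      ultimately show ?thesis
        using s z(3) by (intro exI[of _ "z - b *\<^sub>R n"]) auto
    qed
  qed
qed

section \<open>Extended parameters and strong convexity\<close>

lemma recip_nonneg: "0 \<le> \<beta> \<Longrightarrow> 0 \<le> recip \<beta>"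
  unfolding recip_def by (intro real_of_ereal_pos) simp

lemma ereal_recip: "0 < \<alpha> \<Longrightarrow> ereal (recip \<alpha>) = 1 / \<alpha>"
  unfolding recip_def by (cases \<alpha>) (simp_all add: one_ereal_def)

text \<open>
  At \<open>r = 0\<close> the two conventions \<open>inverse 0 = \<infinity>\<close> and \<open>recip \<infinity> = 0\<close> cancel; this covers \<open>\<alpha> = \<beta>\<close>.
\<close>

lemma recip_inverse_ereal: "recip (inverse (ereal r)) = r"
proof (cases "r = 0")
  case True
  then show ?thesis by (simp add: recip_def)
next
  case False
  then show ?thesis by (simp add: recip_def one_ereal_def divide_inverse)
qed

lemma recip_gam:
  assumes "0 < \<alpha>" "0 < \<beta>"
  shows "recip (gam \<alpha> \<beta>) = recip \<alpha> - recip \<beta>"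
proof -
  have "gam \<alpha> \<beta> = inverse (ereal (recip \<alpha> - recip \<beta>))"
    unfolding gam_def ereal_minus(1)[symmetric] ereal_recip[OF assms(1)] ereal_recip[OF assms(2)] ..
  then show ?thesis
    by (simp only: recip_inverse_ereal)
qed

text \<open>
  The definition treats \<open>\<alpha> = \<infinity>\<close> separately, but there \<open>C = {z}\<close> is itself the ball of radius
  \<open>0\<close> around \<open>z\<close>. One containment therefore serves for all nonzero \<open>\<alpha>\<close>, infinity included.
\<close>

lemma strongly_convex_subset_cball:
  assumes "strongly_convex_set \<alpha> C" "\<alpha> \<noteq> 0" "z \<in> C" "n \<in> normal_cone C z" "norm n = 1"
  shows "C \<subseteq> cball (z - recip \<alpha> *\<^sub>R n) (recip \<alpha>)"
proof (cases "\<alpha> = \<infinity>")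
  case True
  with assms(1,3) show ?thesis
    by (auto simp: strongly_convex_set_def recip_def)
next
  case False
  have "z \<in> frontier C"
    using assms(3-5) by (intro normal_cone_frontier[of z C n]) auto
  with False assms show ?thesis
    by (auto simp: strongly_convex_set_def)
qed

section \<open>Necessity of the interpolation conditions\<close>

theorem theorem3p1:
  fixes \<alpha> \<beta> D :: ereal
    and I :: "'i set" and z v :: "'i \<Rightarrow> real ^ 'd"
    and K :: "'k set" and x :: "'k \<Rightarrow> real ^ 'd" and \<delta> :: "'k \<Rightarrow> real"
  assumes "0 \<le> \<alpha>" and "\<alpha> \<le> \<beta>" and "0 < \<beta>" and "0 \<le> D"
    and "\<And>i. i \<in> I \<Longrightarrow> v i \<noteq> 0"
    and "\<And>k. k \<in> K \<Longrightarrow> 0 \<le> \<delta> k"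
    and "interpolable \<alpha> \<beta> D I z v K x \<delta>"
  shows "interp \<alpha> \<beta> D 1 I z v K x \<delta>"
proof -
  obtain C where C: "closed C" "convex C" "strongly_convex_set \<alpha> C" "smooth_set \<beta> C"
    "ediam C \<le> D"
    and zC: "\<And>i. i \<in> I \<Longrightarrow> z i \<in> C" and vC: "\<And>i. i \<in> I \<Longrightarrow> v i \<in> normal_cone C (z i)"
    and xC: "\<And>k. k \<in> K \<Longrightarrow> x k \<in> inner_parallel (\<delta> k) C"
    using assms(7) unfolding interpolable_def conv_class_def by blast
  define a where "a = recip \<alpha>"
  define b where "b = recip \<beta>"
  define n where "n = (\<lambda>i. v i /\<^sub>R norm (v i))"
  define s where "s = (\<lambda>k. max 0 (\<delta> k - b))"
  have b0: "0 \<le> b"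
    using assms(3) by (simp add: b_def recip_nonneg)
  have s0: "0 \<le> s k" for k
    by (simp add: s_def)
  have nC: "n i \<in> normal_cone C (z i)" "norm (n i) = 1" if "i \<in> I" for i
    unfolding n_def using vC[OF that] assms(5)[OF that] by (simp_all add: normal_cone_scaleR)
  have zball: "cball (z i - b *\<^sub>R n i) b \<subseteq> C" if "i \<in> I" for i
    using C(4) nC[OF that] normal_cone_frontier[OF zC vC assms(5), OF that that that]
    unfolding smooth_set_def b_def by blast
  have "\<exists>w. cball w (b + s k) \<subseteq> C \<and> norm (x k - w) \<le> b - \<delta> k + s k" if "k \<in> K" for k
    unfolding s_def b_def using smooth_set_inscribed_ball_near[OF C(1,2,4) xC assms(6), OF that that] .
  then obtain w where wball: "\<And>k. k \<in> K \<Longrightarrow> cball (w k) (b + s k) \<subseteq> C"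
    and wx: "\<And>k. k \<in> K \<Longrightarrow> norm (x k - w k) \<le> b - \<delta> k + s k"
    by metis
  \<comment> \<open>The three shapes in which an inscribed ball enters the conditions.\<close>
  have strong: "norm (z i - a *\<^sub>R n i - p) \<le> recip (gam \<alpha> \<beta>) - t"
    if "i \<in> I" "cball p (b + t) \<subseteq> C" "0 \<le> t" "\<alpha> \<noteq> 0" for i p t
  proof -
    have "cball p (b + t) \<subseteq> cball (z i - a *\<^sub>R n i) a"
      unfolding a_def
      using that(2) strongly_convex_subset_cball[OF C(3) that(4) zC nC, OF that(1) that(1) that(1)]
      by (rule order_trans)
    then have "dist p (z i - a *\<^sub>R n i) + (b + t) \<le> a"
      using b0 that(3) by (simp add: cball_subset_cball_iff)
    then show ?thesis
      using recip_gam[of \<alpha> \<beta>] assms(1,3) that(4)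
      by (simp add: a_def b_def dist_norm norm_minus_commute)
  qed
  have flat: "n i \<bullet> (p + t *\<^sub>R n i - z i + b *\<^sub>R n i) \<le> 0"
    if "i \<in> I" "cball p (b + t) \<subseteq> C" "0 \<le> t" for i p t
    using normal_cone_ball_le[OF nC that(2), OF that(1) that(1)] b0 that(3) by (simp add: algebra_simps)
  have diam: "norm (p - q) \<le> real_of_ereal D - 2 * b - t - u"
    if "D \<noteq> \<infinity>" "cball p (b + t) \<subseteq> C" "cball q (b + u) \<subseteq> C" "0 \<le> t" "0 \<le> u" for p q t u
    using inscribed_balls_dist_le[OF C(5) assms(4) that(1-3)] b0 that(4,5) by simp
  have zball0: "cball (z i - b *\<^sub>R n i) (b + 0) \<subseteq> C" if "i \<in> I" for i
    using zball[OF that] by simp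
  have n_fold: "v i /\<^sub>R norm (v i) = n i" for i
    by (simp add: n_def)
  have s_fold: "max 0 (\<delta> k - b) = s k" for k
    by (simp add: s_def)
  show ?thesis
    unfolding interp_def Let_def a_def[symmetric] b_def[symmetric] n_fold s_fold
  proof (intro exI[of _ w] conjI ballI impI)
    fix i j assume "i \<in> I" "j \<in> I"
    show "if \<alpha> = 0 then n i \<bullet> (z j - b *\<^sub>R n j - z i + b *\<^sub>R n i) \<le> 0
      else norm (z i - a *\<^sub>R n i - (z j - b *\<^sub>R n j)) \<le> recip (gam \<alpha> \<beta>)"
      using flat[OF \<open>i \<in> I\<close> zball0[OF \<open>j \<in> I\<close>]] strong[OF \<open>i \<in> I\<close> zball0[OF \<open>j \<in> I\<close>]]
      by auto
  next
    fix i k assume "i \<in> I" "k \<in> K"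
    show "if \<alpha> = 0 then n i \<bullet> (w k + s k *\<^sub>R n i - z i + b *\<^sub>R n i) \<le> 0
      else norm (z i - a *\<^sub>R n i - w k) \<le> recip (gam \<alpha> \<beta>) - s k"
      using flat[OF \<open>i \<in> I\<close> wball[OF \<open>k \<in> K\<close>] s0] strong[OF \<open>i \<in> I\<close> wball[OF \<open>k \<in> K\<close>] s0]
      by auto
  next
    fix k assume "k \<in> K"
    then show "norm (x k - w k) \<le> b - \<delta> k + s k"
      by (rule wx)
  next
    fix i j assume "D \<noteq> \<infinity>" "i \<in> I" "j \<in> I"
    then show "norm (z i - b *\<^sub>R n i - (z j - b *\<^sub>R n j)) \<le> 1 * (real_of_ereal D - 2 * b)"
      using diam[OF _ zball0 zball0] by fastforce
  next
    fix i k assume "D \<noteq> \<infinity>" "i \<in> I" "k \<in> K"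
    then show "norm (z i - b *\<^sub>R n i - w k) \<le> 1 * (real_of_ereal D - 2 * b) - s k"
      using diam[OF _ zball0 wball _ s0] by fastforce
  next
    fix k l assume "D \<noteq> \<infinity>" "k \<in> K" "l \<in> K"
    then show "norm (w k - w l) \<le> 1 * (real_of_ereal D - 2 * b) - s k - s l"
      using diam[OF _ wball wball s0 s0] by simp
  qed
qed

end
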